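(* If $D$ is a finite $2$-semi-symmetric digraph, then $D$ is BE-diperfect.
   Context: Digraphs have no loops and no parallel arcs, but may contain both arcs $uv$ and $vu$ (cycles of length two). Two vertices $u,v$ are adjacent if $uv$ or $vu$ is an arc. An arc $uv$ of $D$ is lonely if $vu\notin A(D)$. A digraph is $k$-semi-symmetric if it has at most $k$ lonely arcs. A stable set is a set of pairwise non-adjacent vertices; it is maximum if no stable set has larger cardinality. A path of $D$ is a directed path, i.e. a sequence $v_1v_2\cdots v_\ell$ of distinct vertices ($\ell\ge 1$) with $v_iv_{i+1}\in A(D)$ for $1\le i<\ell$. A path partition of $D$ is a collection of paths whose vertex sets partition $V(D)$. For a stable set $S$, an $S_{\rm BE}$-path partition of $D$ is a path partition $\mathcal P$ such that every $P=x_1x_2\cdots x_k\in\mathcal P$ satisfies $V(P)\cap S=\{x\}$ with $x\in\{x_1,x_k\}$. A digraph satisfies the BE-property if it has an $S_{\rm BE}$-path partition for every maximum stable set $S$. A digraph is BE-diperfect if every induced subdigraph of it satisfies the BE-property. *)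

theory Defs
  imports "Graph_Theory.Graph_Theory" "HOL-Library.Disjoint_Sets"
begin

text \<open>
  Finite digraphs without loops and parallel arcs (2-cycles allowed) are given by the
  locale \<^locale>\<open>digraph\<close>; directed paths, as nonempty lists of distinct vertices, by
  \<^const>\<open>vpath\<close>; induced subdigraphs by \<^const>\<open>induced_subgraph\<close>. The null digraph is
  admitted.
\<close>

definition adjacent :: "('a,'b) pre_digraph \<Rightarrow> 'a \<Rightarrow> 'a \<Rightarrow> bool" where
  "adjacent G u v \<longleftrightarrow> u \<rightarrow>\<^bsub>G\<^esub> v \<or> v \<rightarrow>\<^bsub>G\<^esub> u"

definition lonely_arcs :: "('a,'b) pre_digraph \<Rightarrow> 'b set" where
  "lonely_arcs G = {e \<in> arcs G. \<not> head G e \<rightarrow>\<^bsub>G\<^esub> tail G e}"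

definition semi_symmetric :: "nat \<Rightarrow> ('a,'b) pre_digraph \<Rightarrow> bool" where
  "semi_symmetric k G \<longleftrightarrow> finite (lonely_arcs G) \<and> card (lonely_arcs G) \<le> k"

definition stable_set :: "('a,'b) pre_digraph \<Rightarrow> 'a set \<Rightarrow> bool" where
  "stable_set G S \<longleftrightarrow> S \<subseteq> verts G \<and> pairwise (\<lambda>u v. \<not> adjacent G u v) S"

text \<open>
  Cardinalities are compared by \<^const>\<open>card\<close>, so the next definition is meant for digraphs
  with finitely many vertices only.
\<close>

definition maximum_stable_set :: "('a,'b) pre_digraph \<Rightarrow> 'a set \<Rightarrow> bool" where
  "maximum_stable_set G S \<longleftrightarrow> stable_set G S \<and> (\<forall>T. stable_set G T \<longrightarrow> card T \<le> card S)"

definition path_partition :: "('a,'b) pre_digraph \<Rightarrow> 'a list set \<Rightarrow> bool" where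
  "path_partition G P \<longleftrightarrow>
     (\<forall>p\<in>P. vpath p G) \<and> disjoint_family_on set P \<and> (\<Union>p\<in>P. set p) = verts G"

definition BE_path_partition :: "('a,'b) pre_digraph \<Rightarrow> 'a set \<Rightarrow> 'a list set \<Rightarrow> bool" where
  "BE_path_partition G S P \<longleftrightarrow>
     path_partition G P \<and> (\<forall>p\<in>P. \<exists>x\<in>{hd p, last p}. set p \<inter> S = {x})"

definition BE_property :: "('a,'b) pre_digraph \<Rightarrow> bool" where
  "BE_property G \<longleftrightarrow> (\<forall>S. maximum_stable_set G S \<longrightarrow> (\<exists>P. BE_path_partition G S P))"

definition BE_diperfect :: "('a,'b) pre_digraph \<Rightarrow> bool" where
  "BE_diperfect G \<longleftrightarrow> (\<forall>H. induced_subgraph H G \<longrightarrow> BE_property H)"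

end

theory Submission
  imports Defs
begin

text \<open>
  The theorem follows from the Gallai--Milgram theorem, applied to a reorientation of the digraph.

  Let \<open>S\<close> be a maximum stable set and \<open>W\<close> the set of the other vertices. Keep the arcs inside \<open>W\<close>
  and orient every edge between \<open>W\<close> and \<open>S\<close> away from \<open>S\<close>. Adjacency does not change, so
  Gallai--Milgram (lemma \<open>gallai_milgram\<close>) splits the vertices into at most \<open>card S\<close> paths of the
  new relation. Vertices of \<open>S\<close> have no in-neighbours, so each of them begins a path; by
  counting, each path begins in \<open>S\<close> and then stays in \<open>W\<close> (lemma
  \<open>partition_rooted_at_stable_set\<close>). Such a path \<open>s w\<^sub>1 \<dots> w\<^sub>k\<close> is a path of the digraph, except that
  the edge between \<open>s\<close> and \<open>w\<^sub>1\<close> may only be present as the arc \<open>w\<^sub>1 s\<close>.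

  At most two lonely arcs leave three possibilities (lemma \<open>rooted_path_orientation\<close>). If no
  lonely arc enters \<open>S\<close>, then \<open>s w\<^sub>1\<close> is an arc. If no lonely arc leaves \<open>S\<close>, the
  same argument works after reversing all arcs. Otherwise one lonely arc enters \<open>S\<close> and one leaves it,
  so no lonely arc has both ends in \<open>W\<close>; then \<open>w\<^sub>k \<dots> w\<^sub>1\<close> is a path as well, and the path can be
  read backwards, ending in \<open>s\<close>, whenever the edge at \<open>s\<close> has the wrong direction.

  Induced subdigraphs inherit the bound on lonely arcs, so the argument covers them too.
\<close>

section \<open>The Gallai--Milgram theorem\<close>

text \<open>
  \<open>path_heads r V I\<close> expresses that \<open>V\<close> can be partitioned into finitely many paths of the relation
  \<open>r\<close> whose first vertices form the set \<open>I\<close>. Only the set of first vertices matters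
  for the Gallai--Milgram argument; building paths by prepending vertices avoids
  handling the paths themselves. They are recovered in \<open>path_heads_imp_paths\<close>.
\<close>

inductive path_heads :: "('a \<Rightarrow> 'a \<Rightarrow> bool) \<Rightarrow> 'a set \<Rightarrow> 'a set \<Rightarrow> bool" for r where
  empty: "path_heads r {} {}"
| single: "path_heads r V I \<Longrightarrow> x \<notin> V \<Longrightarrow> path_heads r (insert x V) (insert x I)"
| prepend: "path_heads r V I \<Longrightarrow> x \<notin> V \<Longrightarrow> y \<in> I \<Longrightarrow> r x y \<Longrightarrow>
    path_heads r (insert x V) (insert x (I - {y}))"

lemma path_heads_subset: "path_heads r V I \<Longrightarrow> I \<subseteq> V"
  by (induction rule: path_heads.induct) auto

lemma path_heads_finite: "path_heads r V I \<Longrightarrow> finite V"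
  by (induction rule: path_heads.induct) auto

lemma path_heads_trivial: "finite V \<Longrightarrow> path_heads r V V"
  by (induction rule: finite_induct) (auto intro: path_heads.intros)

text \<open>
  Deleting the first vertex of a path either removes the whole path or makes the
  second vertex a new first vertex.
\<close>

lemma path_heads_remove:
  assumes "path_heads r V I" "z \<in> I"
  shows "path_heads r (V - {z}) (I - {z}) \<or>
    (\<exists>z'. z' \<in> V - {z} \<and> z' \<notin> I \<and> r z z' \<and> path_heads r (V - {z}) (insert z' (I - {z})))"
  using assms
proof (induction rule: path_heads.induct)
  case empty
  then show ?case by simp
next
  case (single V I x)
  note sub = path_heads_subset[OF single.hyps(1)]
  show ?case
  proof (cases "z = x")
    case True
    then have "insert x V - {z} = V" "insert x I - {z} = I" using single.hyps sub by auto
    then show ?thesis using single.hyps by simp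
  next
    case False
    then have eq: "insert x V - {z} = insert x (V - {z})" "insert x I - {z} = insert x (I - {z})"
      by auto
    from False single.prems have "z \<in> I" by simp
    from single.IH[OF this] show ?thesis
    proof (elim disjE exE conjE)
      assume "path_heads r (V - {z}) (I - {z})"
      then have "path_heads r (insert x (V - {z})) (insert x (I - {z}))"
        by (rule path_heads.single) (use single.hyps in blast)
      then show ?thesis unfolding eq by blast
    next
      fix z' assume z': "z' \<in> V - {z}" "z' \<notin> I" "r z z'" "path_heads r (V - {z}) (insert z' (I - {z}))"
      have "path_heads r (insert x (V - {z})) (insert x (insert z' (I - {z})))"
        by (rule path_heads.single[OF z'(4)]) (use single.hyps in blast)
      then have "path_heads r (insert x (V - {z})) (insert z' (insert x (I - {z})))"
        by (simp only: insert_commute)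
      moreover have "z' \<in> insert x (V - {z})" "z' \<notin> insert x I" using z' single.hyps by auto
      ultimately show ?thesis unfolding eq using z'(3) by blast
    qed
  qed
next
  case (prepend V I x y)
  note sub = path_heads_subset[OF prepend.hyps(1)]
  show ?case
  proof (cases "z = x")
    case True
    then have eq: "insert x V - {z} = V" "insert y (insert x (I - {y}) - {z}) = I"
      using prepend.hyps sub by auto
    then have "path_heads r (insert x V - {z}) (insert y (insert x (I - {y}) - {z}))"
      using prepend.hyps by simp
    moreover have "y \<in> insert x V - {z}" "y \<notin> insert x (I - {y})" "r z y"
      using True prepend.hyps sub by auto
    ultimately show ?thesis by blast
  next
    case False
    then have z: "z \<in> I" "z \<noteq> y" using prepend.prems by auto
    have eqV: "insert x V - {z} = insert x (V - {z})" using False by auto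
    from prepend.IH[OF z(1)] show ?thesis
    proof (elim disjE exE conjE)
      assume "path_heads r (V - {z}) (I - {z})"
      then have "path_heads r (insert x (V - {z})) (insert x (I - {z} - {y}))"
        by (rule path_heads.prepend) (use prepend.hyps z in blast)+
      moreover have "insert x (I - {z} - {y}) = insert x (I - {y}) - {z}"
        using False by auto
      ultimately show ?thesis unfolding eqV by simp
    next
      fix z' assume z': "z' \<in> V - {z}" "z' \<notin> I" "r z z'" "path_heads r (V - {z}) (insert z' (I - {z}))"
      have "path_heads r (insert x (V - {z})) (insert x (insert z' (I - {z}) - {y}))"
        by (rule path_heads.prepend[OF z'(4)]) (use prepend.hyps z in blast)+
      moreover have "insert x (insert z' (I - {z}) - {y}) = insert z' (insert x (I - {y}) - {z})"
        using False z' prepend.hyps by auto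
      moreover have "z' \<in> insert x (V - {z})" "z' \<notin> insert x (I - {y})"
        using z' prepend.hyps by auto
      ultimately show ?thesis unfolding eqV using z'(3) by metis
    qed
  qed
qed

text \<open>
  Two first vertices \<open>x\<close>, \<open>y\<close> with \<open>r x y\<close> exist as long as there are more than \<open>k\<close> paths. If \<open>x\<close>
  is a path by itself, put it in front of \<open>y\<close>. Otherwise remove \<open>x\<close> from its path, whose next vertex
  \<open>x'\<close> becomes a first vertex, and use induction on the rest. If \<open>x'\<close> or \<open>y\<close> is still a first
  vertex afterwards, \<open>x\<close> can be put in front of it, and the number of paths stays at most \<open>k\<close>.
  If neither is, then \<open>x\<close> becomes a path of its own: this may give \<open>k + 1\<close> paths, but \<open>y\<close> has
  disappeared from the first vertices. So \<open>V\<close> stays the same and the first vertices shrink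
  in this case, which is why the induction measure has two summands.
\<close>

lemma gallai_milgram:
  assumes "path_heads r V I"
    and "\<And>T. T \<subseteq> V \<Longrightarrow> pairwise (\<lambda>x y. \<not> r x y) T \<Longrightarrow> card T \<le> k"
  shows "\<exists>J\<subseteq>I. card J \<le> k \<and> path_heads r V J"
  using assms
proof (induction "card V + card I" arbitrary: V I rule: less_induct)
  case less
  note fin = path_heads_finite[OF less.prems(1)] and sub = path_heads_subset[OF less.prems(1)]
  have finI: "finite I" using fin sub finite_subset by blast
  show ?case
  proof (cases "card I \<le> k")
    case True
    then show ?thesis using less.prems by blast
  next
    case False
    then have "\<not> pairwise (\<lambda>x y. \<not> r x y) I" using less.prems(2)[OF sub] by blast
    then obtain x y where xy: "x \<in> I" "y \<in> I" "x \<noteq> y" "r x y"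
      unfolding pairwise_def by blast
    then have xV: "insert x (V - {x}) = V" "x \<in> V" using sub by auto
    have shrink: ?thesis if "path_heads r V J" "J \<subseteq> I - {y}" for J
    proof -
      have "J \<subset> I" using that xy by blast
      then have "card J < card I" using finI psubset_card_mono by blast
      then have "\<exists>K\<subseteq>J. card K \<le> k \<and> path_heads r V K"
        by (intro less.hyps that less.prems(2)) simp_all
      then show ?thesis using \<open>J \<subset> I\<close> by (meson psubset_imp_subset subset_trans)
    qed
    have attach: ?thesis
      if J: "path_heads r (V - {x}) J" "card J \<le> k" "J - {w} \<subseteq> I" and w: "w \<in> J" "r x w" for J w
    proof -
      have "path_heads r (insert x (V - {x})) (insert x (J - {w}))"
        by (rule path_heads.prepend) (use J w in blast)+
      then have "path_heads r V (insert x (J - {w}))" using xV by simp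
      moreover have "finite J"
        using path_heads_finite[OF J(1)] path_heads_subset[OF J(1)] finite_subset by blast
      then have "card (insert x (J - {w})) \<le> k"
        using J(2) w(1) card_Suc_Diff1[of J w] card_insert_if[of "J - {w}" x]
        by (simp split: if_splits)
      moreover have "insert x (J - {w}) \<subseteq> I" using J(3) xy(1) by blast
      ultimately show ?thesis by blast
    qed
    from path_heads_remove[OF less.prems(1) xy(1)] show ?thesis
    proof (elim disjE exE conjE)
      assume "path_heads r (V - {x}) (I - {x})"
      then have "path_heads r (insert x (V - {x})) (insert x (I - {x} - {y}))"
        by (rule path_heads.prepend) (use xy in blast)+
      then have "path_heads r V (insert x (I - {x} - {y}))" using xV by simp
      then show ?thesis by (rule shrink) (use xy in blast)
    next
      fix x' assume x': "x' \<in> V - {x}" "x' \<notin> I" "r x x'" "path_heads r (V - {x}) (insert x' (I - {x}))"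
      have "card (V - {x}) < card V" using fin xV by (meson card_Diff1_less)
      moreover have "card (insert x' (I - {x})) = card I"
        using finI x'(2) xy(1) card_Suc_Diff1[of I x] by (simp del: card_Diff_insert)
      ultimately have "card (V - {x}) + card (insert x' (I - {x})) < card V + card I" by linarith
      then have "\<exists>J\<subseteq>insert x' (I - {x}). card J \<le> k \<and> path_heads r (V - {x}) J"
        by (rule less.hyps[OF _ x'(4)]) (use less.prems(2) in blast)
      then obtain J where J: "J \<subseteq> insert x' (I - {x})" "card J \<le> k" "path_heads r (V - {x}) J"
        by blast
      consider "x' \<in> J" | "x' \<notin> J" "y \<in> J" | "x' \<notin> J" "y \<notin> J" by blast
      then show ?thesis
      proof cases
        case 1
        show ?thesis by (rule attach[OF J(3,2) _ 1 x'(3)]) (use J(1) in blast)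
      next
        case 2
        show ?thesis by (rule attach[OF J(3,2) _ 2(2) xy(4)]) (use J(1) 2 in blast)
      next
        case 3
        have "path_heads r (insert x (V - {x})) (insert x J)"
          by (rule path_heads.single[OF J(3)]) blast
        then have "path_heads r V (insert x J)" using xV by simp
        then show ?thesis by (rule shrink) (use 3 J(1) xy in blast)
      qed
    qed
  qed
qed

lemma path_heads_imp_paths:
  assumes "path_heads r V I"
  shows "\<exists>P. (\<forall>p\<in>P. p \<noteq> [] \<and> distinct p \<and> successively r p) \<and>
    disjoint_family_on set P \<and> (\<Union>p\<in>P. set p) = V \<and> hd ` P = I"
  using assms
proof (induction rule: path_heads.induct)
  case empty
  show ?case by (intro exI[of _ "{}"]) (auto simp: disjoint_family_on_def)
next
  case (single V I x)
  then obtain P where P: "\<forall>p\<in>P. p \<noteq> [] \<and> distinct p \<and> successively r p"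
    "disjoint_family_on set P" "(\<Union>p\<in>P. set p) = V" "hd ` P = I" by blast
  have "disjoint_family_on set (insert [x] P)"
    using P single.hyps unfolding disjoint_family_on_def by auto
  then show ?case using P by (intro exI[of _ "insert [x] P"]) auto
next
  case (prepend V I x y)
  then obtain P where P: "\<forall>p\<in>P. p \<noteq> [] \<and> distinct p \<and> successively r p"
    "disjoint_family_on set P" "(\<Union>p\<in>P. set p) = V" "hd ` P = I" by blast
  then obtain q where q: "q \<in> P" "hd q = y" using prepend.hyps by blast
  then have qne: "q \<noteq> []" using P by blast
  have uniq: "p = q" if "p \<in> P" "hd p = y" for p
  proof -
    have "p \<noteq> []" using that(1) P(1) by blast
    then have "y \<in> set p \<inter> set q" using that(2) q(2) qne hd_in_set by fastforce
    then show ?thesis using P(2) that(1) q(1) unfolding disjoint_family_on_def by blast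
  qed
  let ?P = "insert (x # q) (P - {q})"
  have "\<forall>p\<in>?P. p \<noteq> [] \<and> distinct p \<and> successively r p"
    using P q qne prepend.hyps by (auto simp: successively_Cons)
  moreover have "disjoint_family_on set ?P"
  proof -
    have new: "set (x # q) \<inter> set p = {}" if "p \<in> P - {q}" for p
    proof -
      have "set q \<inter> set p = {}" using P(2) q(1) that unfolding disjoint_family_on_def by blast
      moreover have "x \<notin> set p" using that P(3) prepend.hyps(2) by blast
      ultimately show ?thesis by simp
    qed
    have "disjoint_family_on set (P - {q})"
      using P(2) by (rule disjoint_family_on_mono[rotated]) blast
    then show ?thesis using new unfolding disjoint_family_on_def by (metis Int_commute insert_iff)
  qed
  moreover have "(\<Union>p\<in>?P. set p) = insert x V" using P(3) q by auto
  moreover have "hd ` (P - {q}) = I - {y}"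
  proof (intro equalityI subsetI)
    fix z assume "z \<in> hd ` (P - {q})"
    then obtain p where p: "p \<in> P" "p \<noteq> q" "z = hd p" by blast
    then have "z \<noteq> y" using uniq by metis
    then show "z \<in> I - {y}" using p P(4) by blast
  next
    fix z assume z: "z \<in> I - {y}"
    then obtain p where "p \<in> P" "z = hd p" using P(4) by blast
    moreover from this have "p \<noteq> q" using z q(2) by auto
    ultimately show "z \<in> hd ` (P - {q})" by blast
  qed
  then have "hd ` ?P = insert x (I - {y})" by simp
  ultimately show ?case by blast
qed

section \<open>Paths rooted at a maximum stable set\<close>

text \<open>
  Apply Gallai--Milgram to the relation \<open>r\<close> that keeps \<open>e\<close> outside \<open>S\<close> and makes every vertex of
  \<open>S\<close> a source. It has the same stable sets as \<open>adj\<close>, so at most \<open>card S\<close> paths suffice; the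
  vertices of \<open>S\<close> can only be first vertices, and there is no room for others. Only adjacency
  is known between the first two vertices of a path.
\<close>

lemma partition_rooted_at_stable_set:
  fixes V :: "'a set"
  assumes fin: "finite V" and SV: "S \<subseteq> V"
    and adj: "\<And>x y. adj x y \<longleftrightarrow> e x y \<or> e y x"
    and stable: "pairwise (\<lambda>x y. \<not> adj x y) S"
    and maximum: "\<And>T. T \<subseteq> V \<Longrightarrow> pairwise (\<lambda>x y. \<not> adj x y) T \<Longrightarrow> card T \<le> card S"
  shows "\<exists>P. disjoint_family_on set P \<and> (\<Union>p\<in>P. set p) = V \<and>
    (\<forall>p\<in>P. \<exists>s w. p = s # w \<and> s \<in> S \<and> set w \<inter> S = {} \<and> distinct p \<and>
      successively e w \<and> (w \<noteq> [] \<longrightarrow> adj s (hd w)))"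
proof -
  define r where "r x y \<longleftrightarrow> adj x y \<and> y \<notin> S \<and> (x \<notin> S \<longrightarrow> e x y)" for x y
  have adj_imp_r: "r x y \<or> r y x" if "adj x y" "x \<notin> S \<or> y \<notin> S" for x y
    using that adj[of x y] adj[of y x] by (auto simp: r_def)
  have stable_r: "pairwise (\<lambda>x y. \<not> adj x y) T" if T: "pairwise (\<lambda>x y. \<not> r x y) T" for T
  proof (rule pairwiseI)
    fix x y assume xy: "x \<in> T" "y \<in> T" "x \<noteq> y"
    then have "\<not> r x y" "\<not> r y x" using T by (auto simp: pairwise_def)
    moreover have "\<not> adj x y" if "x \<in> S" "y \<in> S"
      using that stable xy(3) by (simp add: pairwise_def)
    ultimately show "\<not> adj x y" using adj_imp_r by blast
  qed
  have "card T \<le> card S" if "T \<subseteq> V" "pairwise (\<lambda>x y. \<not> r x y) T" for T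
    by (rule maximum[OF that(1) stable_r[OF that(2)]])
  from gallai_milgram[OF path_heads_trivial[OF fin] this]
  obtain J where J: "card J \<le> card S" "path_heads r V J" by blast
  from path_heads_imp_paths[OF J(2)] obtain P
    where P: "\<And>p. p \<in> P \<Longrightarrow> p \<noteq> [] \<and> distinct p \<and> successively r p"
      "disjoint_family_on set P" "(\<Union>p\<in>P. set p) = V" "hd ` P = J" by blast
  have tails: "set w \<inter> S = {}" if "successively r (s # w)" for s w
    using that by (induction w arbitrary: s) (auto simp: r_def)
  have "S \<subseteq> J"
  proof
    fix s assume s: "s \<in> S"
    then obtain p where p: "p \<in> P" "s \<in> set p" using SV P(3) by blast
    then obtain h w where hw: "p = h # w" using P(1) by (cases p) auto
    then have "s = h" using tails[of h w] P(1)[OF p(1)] p(2) s by auto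
    then show "s \<in> J" using P(4) p(1) hw by force
  qed
  moreover have "finite J"
    using path_heads_subset[OF J(2)] fin finite_subset by blast
  ultimately have "S = J" using J(1) card_seteq by blast
  have "\<exists>s w. p = s # w \<and> s \<in> S \<and> set w \<inter> S = {} \<and> distinct p \<and>
      successively e w \<and> (w \<noteq> [] \<longrightarrow> adj s (hd w))" if p: "p \<in> P" for p
  proof -
    obtain s w where sw: "p = s # w" using P(1)[OF p] by (cases p) auto
    have s: "s \<in> S" using \<open>S = J\<close> P(4) p sw by force
    have succ: "successively r (s # w)" using P(1)[OF p] sw by blast
    note w = tails[OF succ]
    have "successively e w"
      by (rule successively_mono[of r]) (use succ w in \<open>auto simp: successively_Cons r_def\<close>)
    moreover have "w \<noteq> [] \<longrightarrow> adj s (hd w)" using succ by (auto simp: successively_Cons r_def)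
    ultimately show ?thesis using sw s w P(1)[OF p] by blast
  qed
  then show ?thesis using P(2,3) by blast
qed

section \<open>Digraphs with at most two lonely arcs\<close>

lemma vpath_iff_successively:
  "vpath p G \<longleftrightarrow>
    p \<noteq> [] \<and> distinct p \<and> set p \<subseteq> verts G \<and> successively (\<lambda>u v. u \<rightarrow>\<^bsub>G\<^esub> v) p"
proof -
  have "set (vwalk_arcs p) \<subseteq> arcs_ends G \<longleftrightarrow> successively (\<lambda>u v. u \<rightarrow>\<^bsub>G\<^esub> v) p"
    by (induction p rule: vwalk_arcs.induct) auto
  then show ?thesis unfolding vpath_def vwalk_def by blast
qed

lemma semi_symmetric_induced_subgraph:
  assumes "semi_symmetric k G" "induced_subgraph H G"
  shows "semi_symmetric k H"
proof -
  have ht: "head H = head G" "tail H = tail G"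
    and arcs: "arcs H = {e \<in> arcs G. tail G e \<in> verts H \<and> head G e \<in> verts H}"
    using assms(2) unfolding induced_subgraph_def subgraph_def compatible_def by auto
  have "lonely_arcs H \<subseteq> lonely_arcs G"
    unfolding lonely_arcs_def arcs_ends_conv ht by (auto simp: arcs image_iff)
  then show ?thesis
    using assms(1) unfolding semi_symmetric_def by (meson card_mono finite_subset le_trans)
qed

lemma lonely_arcE:
  assumes "u \<rightarrow>\<^bsub>G\<^esub> v" "\<not> v \<rightarrow>\<^bsub>G\<^esub> u"
  obtains a where "a \<in> lonely_arcs G" "tail G a = u" "head G a = v"
  using assms unfolding lonely_arcs_def arcs_ends_conv by auto

text \<open>
  The path \<open>s # w\<close> is correct up to the direction of its first edge, and this can be repaired
  because the distinguished vertex may stand at either end. One choice of \<open>e\<close>, the arcs of the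
  digraph or their reverses, serves all paths. Two is the largest admissible number of lonely arcs: if one
  enters and one leaves \<open>S\<close>, none is left to make \<open>w\<close> irreversible.
\<close>

lemma rooted_path_orientation:
  assumes semi: "semi_symmetric 2 G"
  obtains e where "\<And>u v. adjacent G u v \<longleftrightarrow> e u v \<or> e v u"
    and "\<And>s w. s \<in> S \<Longrightarrow> set w \<inter> S = {} \<Longrightarrow> successively e w \<Longrightarrow> (w \<noteq> [] \<longrightarrow> adjacent G s (hd w)) \<Longrightarrow>
      successively (\<lambda>u v. u \<rightarrow>\<^bsub>G\<^esub> v) (s # w) \<or> successively (\<lambda>u v. u \<rightarrow>\<^bsub>G\<^esub> v) (rev (s # w))"
proof -
  consider (no_enter) "\<And>a. a \<in> lonely_arcs G \<Longrightarrow> head G a \<in> S \<Longrightarrow> tail G a \<in> S"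
    | (no_leave) "\<And>a. a \<in> lonely_arcs G \<Longrightarrow> tail G a \<in> S \<Longrightarrow> head G a \<in> S"
    | (both) a b where "a \<in> lonely_arcs G" "head G a \<in> S" "tail G a \<notin> S"
        "b \<in> lonely_arcs G" "tail G b \<in> S" "head G b \<notin> S"
    by blast
  then show thesis
  proof cases
    case no_enter
    have out: "s \<rightarrow>\<^bsub>G\<^esub> v" if "s \<in> S" "v \<notin> S" "adjacent G s v" for s v
      using that no_enter unfolding adjacent_def by (metis lonely_arcE)
    show thesis
    proof (rule that[of "\<lambda>u v. u \<rightarrow>\<^bsub>G\<^esub> v"])
      fix s w
      assume w: "s \<in> S" "set w \<inter> S = {}" "successively (\<lambda>u v. u \<rightarrow>\<^bsub>G\<^esub> v) w" "w \<noteq> [] \<longrightarrow> adjacent G s (hd w)"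
      have "hd w \<notin> S" if "w \<noteq> []" using that w(2) hd_in_set by blast
      then show "successively (\<lambda>u v. u \<rightarrow>\<^bsub>G\<^esub> v) (s # w) \<or> successively (\<lambda>u v. u \<rightarrow>\<^bsub>G\<^esub> v) (rev (s # w))"
        using w out by (auto simp: successively_Cons)
    qed (simp add: adjacent_def)
  next
    case no_leave
    have inw: "v \<rightarrow>\<^bsub>G\<^esub> s" if "s \<in> S" "v \<notin> S" "adjacent G s v" for s v
      using that no_leave unfolding adjacent_def by (metis lonely_arcE)
    show thesis
    proof (rule that[of "\<lambda>u v. v \<rightarrow>\<^bsub>G\<^esub> u"])
      fix s w
      assume w: "s \<in> S" "set w \<inter> S = {}" "successively (\<lambda>u v. v \<rightarrow>\<^bsub>G\<^esub> u) w" "w \<noteq> [] \<longrightarrow> adjacent G s (hd w)"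
      have "hd w \<notin> S" if "w \<noteq> []" using that w(2) hd_in_set by blast
      then have "successively (\<lambda>u v. v \<rightarrow>\<^bsub>G\<^esub> u) (s # w)"
        using w inw by (auto simp: successively_Cons)
      then show "successively (\<lambda>u v. u \<rightarrow>\<^bsub>G\<^esub> v) (s # w) \<or> successively (\<lambda>u v. u \<rightarrow>\<^bsub>G\<^esub> v) (rev (s # w))"
        unfolding successively_rev by blast
    qed (auto simp: adjacent_def)
  next
    case both
    \<comment> \<open>The two lonely arcs are used up, so all arcs outside \<open>S\<close> are symmetric and \<open>w\<close> may be reversed.\<close>
    have "a \<noteq> b" using both by blast
    then have "card {a, b} = 2" by simp
    then have "{a, b} = lonely_arcs G"
      using semi both(1,4) by (intro card_seteq) (auto simp: semi_symmetric_def)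
    then have sym: "v \<rightarrow>\<^bsub>G\<^esub> u" if "u \<notin> S" "v \<notin> S" "u \<rightarrow>\<^bsub>G\<^esub> v" for u v
      using that both by (metis lonely_arcE insertE singletonD)
    show thesis
    proof (rule that[of "\<lambda>u v. u \<rightarrow>\<^bsub>G\<^esub> v"])
      fix s w
      assume w: "s \<in> S" "set w \<inter> S = {}" "successively (\<lambda>u v. u \<rightarrow>\<^bsub>G\<^esub> v) w" "w \<noteq> [] \<longrightarrow> adjacent G s (hd w)"
      have "successively (\<lambda>u v. v \<rightarrow>\<^bsub>G\<^esub> u) w"
        by (rule successively_mono[OF w(3)]) (use w(2) sym in blast)
      then have "successively (\<lambda>u v. u \<rightarrow>\<^bsub>G\<^esub> v) (s # w) \<or> successively (\<lambda>u v. v \<rightarrow>\<^bsub>G\<^esub> u) (s # w)"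
        using w by (auto simp: successively_Cons adjacent_def)
      then show "successively (\<lambda>u v. u \<rightarrow>\<^bsub>G\<^esub> v) (s # w) \<or> successively (\<lambda>u v. u \<rightarrow>\<^bsub>G\<^esub> v) (rev (s # w))"
        unfolding successively_rev by blast
    qed (simp add: adjacent_def)
  qed
qed

lemma semi_symmetric_2_imp_BE_property:
  assumes "digraph G" and semi: "semi_symmetric 2 G"
  shows "BE_property G"
  unfolding BE_property_def
proof (intro allI impI)
  interpret digraph G by fact
  fix S assume "maximum_stable_set G S"
  then have S: "stable_set G S" and max: "\<And>T. stable_set G T \<Longrightarrow> card T \<le> card S"
    unfolding maximum_stable_set_def by auto
  let ?path = "successively (\<lambda>u v. u \<rightarrow>\<^bsub>G\<^esub> v)"
  from rooted_path_orientation[OF semi, of S] obtain e where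
    e: "\<And>u v. adjacent G u v \<longleftrightarrow> e u v \<or> e v u" and
    orient: "\<And>s w. s \<in> S \<Longrightarrow> set w \<inter> S = {} \<Longrightarrow> successively e w \<Longrightarrow>
      (w \<noteq> [] \<longrightarrow> adjacent G s (hd w)) \<Longrightarrow> ?path (s # w) \<or> ?path (rev (s # w))"
    by blast
  have "\<exists>P. disjoint_family_on set P \<and> (\<Union>p\<in>P. set p) = verts G \<and>
    (\<forall>p\<in>P. \<exists>s w. p = s # w \<and> s \<in> S \<and> set w \<inter> S = {} \<and> distinct p \<and>
      successively e w \<and> (w \<noteq> [] \<longrightarrow> adjacent G s (hd w)))"
    by (rule partition_rooted_at_stable_set) (use S max e in \<open>auto simp: stable_set_def\<close>)
  then obtain P where P: "disjoint_family_on set P" "(\<Union>p\<in>P. set p) = verts G"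
    and rooted: "\<forall>p\<in>P. \<exists>s w. p = s # w \<and> s \<in> S \<and> set w \<inter> S = {} \<and> distinct p \<and>
      successively e w \<and> (w \<noteq> [] \<longrightarrow> adjacent G s (hd w))"
    by (elim exE conjE)
  \<comment> \<open>Every path of \<open>P\<close> is, read in one of its two directions, a path of the digraph.\<close>
  define f where "f p = (if ?path p then p else rev p)" for p
  have set_f: "set (f p) = set p" for p by (simp add: f_def)
  have f: "vpath (f p) G \<and> (\<exists>x\<in>{hd (f p), last (f p)}. set (f p) \<inter> S = {x})" if p: "p \<in> P" for p
  proof -
    from bspec[OF rooted p] obtain s w where sw: "p = s # w" "s \<in> S" "set w \<inter> S = {}" "distinct p"
      and w: "successively e w" "w \<noteq> [] \<longrightarrow> adjacent G s (hd w)"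
      by (elim exE conjE)
    have path: "?path p \<or> ?path (rev p)"
      unfolding sw(1) by (rule orient[OF sw(2,3) w])
    have "set (f p) \<subseteq> verts G" using P(2) p set_f by blast
    moreover have "?path (f p)"
      using path unfolding f_def by presburger
    moreover have "f p \<noteq> []" "distinct (f p)"
      using sw(1,4) by (simp_all add: f_def)
    moreover have "s \<in> {hd (f p), last (f p)}"
      using sw(1) by (simp add: f_def)
    moreover have "set (f p) \<inter> S = {s}" unfolding set_f using sw(1-3) by auto
    ultimately show ?thesis unfolding vpath_iff_successively by blast
  qed
  have "disjoint_family_on set (f ` P)"
    unfolding disjoint_family_on_def
  proof (intro ballI impI)
    fix p' q' assume "p' \<in> f ` P" "q' \<in> f ` P" "p' \<noteq> q'"
    then obtain p q where "p \<in> P" "q \<in> P" "p' = f p" "q' = f q" "p \<noteq> q" by blast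
    then show "set p' \<inter> set q' = {}" using P(1) by (simp add: set_f disjoint_family_on_def)
  qed
  then have "BE_path_partition G S (f ` P)"
    unfolding BE_path_partition_def path_partition_def using f P(2) by (simp add: set_f)
  then show "\<exists>P. BE_path_partition G S P" by blast
qed

theorem theorem7p3:
  fixes D :: "('a,'b) pre_digraph"
  assumes "digraph D" and "semi_symmetric 2 D"
  shows "BE_diperfect D"
  unfolding BE_diperfect_def
  using assms digraph.digraphI_induced semi_symmetric_induced_subgraph
    semi_symmetric_2_imp_BE_property by blast

end
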